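(* Let $\Omega\subset\mathbb{R}^n$, $n\ge 3$, be a bounded open set with $C^\infty$ boundary, and let $0<\alpha<1$. Let $A^{(j)}\in C(\overline{\Omega};S^j)$ be such that $A^{(j)}|_{\partial\Omega}=0$, $j=1,2,3$, and let $q\in L^\infty(\Omega)$. If $$\sum_{j=1}^3\sum_{i_1,\dots,i_j=1}^n\int_\Omega A^{(j)}_{i_1\dots i_j}(x)\big(v^{(1)}D^j_{i_1\dots i_j}v^{(2)}+v^{(2)}D^j_{i_1\dots i_j}v^{(1)}\big)v^{(0)}\,dx+\int_\Omega q(x)v^{(1)}v^{(2)}v^{(0)}\,dx=0$$ for all $v^{(l)}\in C^{4,\alpha}(\overline{\Omega})$ solving $(-\Delta)^2v^{(l)}=0$ in $\Omega$, $l=0,1,2$, then $A^{(j)}=0$ for $j=1,2,3$, and $q=0$ in $\Omega$.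
   Context: $S^j=S^j(\mathbb{R}^n)$ denotes the complex vector space of symmetric $j$-tensors on $\mathbb{R}^n$, i.e. symmetric $\mathbb{R}$-multilinear maps $(\mathbb{R}^n)^j\to\mathbb{C}$, identified with their components $A_{i_1\dots i_j}\in\mathbb{C}$ in the standard basis; $C(\overline{\Omega};S^j)$ is the space of continuous symmetric $j$-tensor fields. All functions are complex-valued, $C^{4,\alpha}(\overline{\Omega})$ is the standard Hölder space, and $D^j_{i_1\dots i_j}=\frac{1}{\mathrm{i}^j}\frac{\partial^j}{\partial x_{i_1}\cdots\partial x_{i_j}}$ with $\mathrm{i}=\sqrt{-1}$. *)

theory Defs
  imports "HOL-Analysis.Analysis"
begin

definition pderiv_at :: "'n::finite \<Rightarrow> (real^'n \<Rightarrow> 'b::real_normed_vector) \<Rightarrow> real^'n \<Rightarrow> 'b" where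
  "pderiv_at i f x = vector_derivative (\<lambda>t. f (x + t *\<^sub>R axis i 1)) (at 0)"

primrec pderivs :: "'n::finite list \<Rightarrow> (real^'n \<Rightarrow> 'b::real_normed_vector) \<Rightarrow> real^'n \<Rightarrow> 'b" where
  "pderivs [] f = f"
| "pderivs (i # is) f = pderiv_at i (pderivs is f)"

definition D_op :: "'n::finite list \<Rightarrow> (real^'n \<Rightarrow> complex) \<Rightarrow> real^'n \<Rightarrow> complex" where
  "D_op is f x = (1 / \<i> ^ length is) * pderivs is f x"

(* The class C^k(U), for open U. The existence of the partial derivatives is required explicitly
   because vector_derivative is a total function. *)
definition Ck_on :: "nat \<Rightarrow> (real^'n::finite) set \<Rightarrow> (real^'n \<Rightarrow> 'b::real_normed_vector) \<Rightarrow> bool" where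
  "Ck_on k U f \<longleftrightarrow>
     (\<forall>is i. length is < k \<longrightarrow>
        (\<forall>x\<in>U. (\<lambda>t. pderivs is f (x + t *\<^sub>R axis i 1)) differentiable (at 0))) \<and>
     (\<forall>is. length is \<le> k \<longrightarrow> continuous_on U (pderivs is f))"

definition smooth_on :: "(real^'n::finite) set \<Rightarrow> (real^'n \<Rightarrow> 'b::real_normed_vector) \<Rightarrow> bool" where
  "smooth_on U f \<longleftrightarrow> (\<forall>k. Ck_on k U f)"

(* Near each boundary point, Omega is the region strictly on one side of the graph of a smooth
   function of the coordinates other than the k-th. Such a function of n - 1 variables is
   represented by a function on R^n that is constant in the direction of axis k. *)
definition smooth_boundary :: "(real^'n::finite) set \<Rightarrow> bool" where
  "smooth_boundary \<Omega> \<longleftrightarrow>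
     (\<forall>p\<in>frontier \<Omega>. \<exists>r>0. \<exists>k. \<exists>s\<in>{1, -1::real}. \<exists>\<gamma>::real^'n \<Rightarrow> real.
        smooth_on UNIV \<gamma> \<and> (\<forall>x t. \<gamma> (x + t *\<^sub>R axis k 1) = \<gamma> x) \<and>
        \<Omega> \<inter> ball p r = {x \<in> ball p r. s * x $ k > \<gamma> x})"

(* The Hoelder space C^{k,alpha} on the closure of a bounded open set Omega: all partial derivatives
   of order at most k extend continuously to the closure, and those of order k are
   alpha-Hoelder continuous. Only the values of f on the closure matter. *)
definition holder_space :: "nat \<Rightarrow> real \<Rightarrow> (real^'n::finite) set \<Rightarrow> (real^'n \<Rightarrow> complex) set" where
  "holder_space k \<alpha> \<Omega> = {f.
     Ck_on k \<Omega> f \<and> continuous_on (closure \<Omega>) f \<and>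
     (\<forall>is. length is \<le> k \<longrightarrow>
        (\<exists>g. continuous_on (closure \<Omega>) g \<and> (\<forall>x\<in>\<Omega>. g x = pderivs is f x))) \<and>
     (\<forall>is. length is = k \<longrightarrow>
        (\<exists>C. \<forall>x\<in>\<Omega>. \<forall>y\<in>\<Omega>. norm (pderivs is f x - pderivs is f y) \<le> C * dist x y powr \<alpha>))}"

definition neg_laplacian :: "(real^'n::finite \<Rightarrow> complex) \<Rightarrow> real^'n \<Rightarrow> complex" where
  "neg_laplacian f x = - (\<Sum>i\<in>UNIV. pderivs [i, i] f x)"

(* Covariant j-tensors are functions of a list of j vectors; their values on lists of any other
   length are junk. *)
type_synonym 'n tensor = "(real^'n) list \<Rightarrow> complex"

definition sym_tensors :: "nat \<Rightarrow> ('n::finite tensor) set" where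
  "sym_tensors j = {T.
     (\<forall>vs k. length vs = j \<and> k < j \<longrightarrow> linear (\<lambda>u. T (vs[k := u]))) \<and>
     (\<forall>vs ws. length vs = j \<and> mset ws = mset vs \<longrightarrow> T ws = T vs)}"

definition tensor_zero :: "nat \<Rightarrow> 'n::finite tensor \<Rightarrow> bool" where
  "tensor_zero j T \<longleftrightarrow> (\<forall>vs. length vs = j \<longrightarrow> T vs = 0)"

definition tensor_comp :: "'n::finite tensor \<Rightarrow> 'n list \<Rightarrow> complex" where
  "tensor_comp T is = T (map (\<lambda>i. axis i 1) is)"

definition cont_sym_tensor_fields ::
    "nat \<Rightarrow> (real^'n::finite) set \<Rightarrow> (real^'n \<Rightarrow> 'n tensor) set" where
  "cont_sym_tensor_fields j S = {A.
     (\<forall>x\<in>S. A x \<in> sym_tensors j) \<and>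
     (\<forall>is. length is = j \<longrightarrow> continuous_on S (\<lambda>x. tensor_comp (A x) is))}"

definition Linfty :: "(real^'n::finite) set \<Rightarrow> (real^'n \<Rightarrow> complex) set" where
  "Linfty \<Omega> = {q. q \<in> borel_measurable (lebesgue_on \<Omega>) \<and>
     (\<exists>C. AE x in lebesgue_on \<Omega>. norm (q x) \<le> C)}"

end

theory Submission
  imports Defs
begin

text \<open>Only biharmonic functions of the form \<open>h\<close> or \<open>x $ b * h\<close> with \<open>h\<close> harmonic are needed. Subtracting the
  identities for \<open>(f, x $ b * g, h)\<close> and \<open>(x $ b * f, g, h)\<close> leaves the integral of
  \<open>\<Sum>j. A j \<cdot> [D j, x $ b] g\<close> against \<open>f * h\<close>. Products of two harmonic exponentials give every
  \<open>exp (i \<eta> \<bullet> x)\<close> (Calderon), so \<open>\<Sum>j. A j \<cdot> [D j, x $ b] g = 0\<close> pointwise for every harmonic \<open>g\<close>.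
  Taking \<open>g\<close> constant, linear and quadratic (\<open>x $ k * x $ l\<close> with \<open>k \<noteq> l\<close>, and \<open>x $ k ^ 2 - x $ l ^ 2\<close>) kills
  \<open>A 1\<close>, \<open>A 2\<close> and, up to a trace, \<open>A 3\<close>; the symmetry of \<open>A 3\<close> excludes the trace. What remains of
  the identity is Calderon's problem for \<open>q\<close>.\<close>

subsection \<open>The algebra generated by coordinates and exponentials\<close>

text \<open>The pairing of \<zeta> with \<open>x\<close> is bilinear, without conjugation, so the
  Laplacian multiplies \<open>cexp \<zeta>\<close> by the sum of the squares of the components of
  \<zeta>, which can vanish for nonzero complex \<zeta>.\<close>

definition cexp :: "complex^'n::finite \<Rightarrow> real^'n \<Rightarrow> complex" where
  "cexp \<zeta> x = exp (\<Sum>i\<in>UNIV. \<zeta> $ i * of_real (x $ i))"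

text \<open>One class that contains all test functions used. Its members have partial derivatives
  everywhere, and these lie in the class again, so membership replaces all differentiability side
  conditions.\<close>

inductive_set exp_polys :: "(real^'n::finite \<Rightarrow> complex) set" where
  const: "(\<lambda>_. c) \<in> exp_polys"
| coord: "(\<lambda>x. of_real (x $ i)) \<in> exp_polys"
| cexp: "cexp \<zeta> \<in> exp_polys"
| add: "f \<in> exp_polys \<Longrightarrow> g \<in> exp_polys \<Longrightarrow> (\<lambda>x. f x + g x) \<in> exp_polys"
| mult: "f \<in> exp_polys \<Longrightarrow> g \<in> exp_polys \<Longrightarrow> (\<lambda>x. f x * g x) \<in> exp_polys"

section \<open>Partial derivatives of exponential polynomials\<close>

lemma cexp_line: "cexp \<zeta> (x + t *\<^sub>R axis i 1) = cexp \<zeta> x * exp (of_real t * \<zeta> $ i)"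
proof -
  have "(\<Sum>j\<in>UNIV. \<zeta> $ j * of_real (t * axis i 1 $ j)) = (\<Sum>j\<in>UNIV. if j = i then of_real t * \<zeta> $ i else 0)"
    by (intro sum.cong) (auto simp: axis_def)
  then show ?thesis
    by (simp add: cexp_def distrib_left sum.distrib exp_add)
qed

lemma has_partial_cexp:
  "((\<lambda>t. cexp \<zeta> (x + t *\<^sub>R axis i 1)) has_vector_derivative \<zeta> $ i * cexp \<zeta> x) (at 0)"
proof -
  have "((\<lambda>z. exp (z * \<zeta> $ i)) has_field_derivative \<zeta> $ i) (at (0::complex))"
    by (rule derivative_eq_intros refl | simp)+
  moreover have "(complex_of_real has_vector_derivative 1) (at 0)"
    using has_vector_derivative_of_real[OF DERIV_ident] by (metis of_real_1)
  ultimately have "((\<lambda>t. exp (complex_of_real t * \<zeta> $ i)) has_vector_derivative \<zeta> $ i) (at 0)"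
    using field_vector_diff_chain_at[of of_real 1 0 "\<lambda>z. exp (z * \<zeta> $ i)"] by (simp add: o_def)
  from has_vector_derivative_mult_right[OF this, of "cexp \<zeta> x"]
  show ?thesis by (simp add: cexp_line mult.commute)
qed

lemma has_partial_coord:
  "((\<lambda>t. complex_of_real ((x + t *\<^sub>R axis i 1) $ b)) has_vector_derivative (if i = b then 1 else 0)) (at 0)"
proof -
  have "((\<lambda>t. (x + t *\<^sub>R axis i 1) $ b) has_real_derivative (if i = b then 1 else 0)) (at 0)"
    by (auto simp: axis_def intro!: derivative_eq_intros)
  from has_vector_derivative_of_real[OF this, where ?'a = complex]
  show ?thesis by (auto split: if_splits)
qed

text \<open>Since \<open>pderiv_at\<close> is total, existence of the derivative has to be proved
  separately. Keeping the derivative inside the class lets the result be iterated to every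
  order.\<close>

lemma exp_polys_partial:
  assumes "f \<in> exp_polys"
  shows "\<exists>g\<in>exp_polys. \<forall>x. ((\<lambda>t. f (x + t *\<^sub>R axis i 1)) has_vector_derivative g x) (at 0)"
  using assms
proof induction
  case (const c)
  show ?case by (rule bexI[of _ "\<lambda>_. 0"]) (auto intro: exp_polys.const)
next
  case (coord b)
  show ?case
    by (rule bexI[of _ "\<lambda>_. if i = b then 1 else 0"]) (use has_partial_coord[of _ i b] in \<open>auto intro: exp_polys.const\<close>)
next
  case (cexp \<zeta>)
  show ?case
    by (rule bexI[of _ "\<lambda>x. \<zeta> $ i * cexp \<zeta> x"]) (auto intro!: exp_polys.intros has_partial_cexp)
next
  case (add f g)
  then obtain f' g' where "f' \<in> exp_polys" "g' \<in> exp_polys"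
    "\<forall>x. ((\<lambda>t. f (x + t *\<^sub>R axis i 1)) has_vector_derivative f' x) (at 0)"
    "\<forall>x. ((\<lambda>t. g (x + t *\<^sub>R axis i 1)) has_vector_derivative g' x) (at 0)" by blast
  then show ?case
    by (intro bexI[of _ "\<lambda>x. f' x + g' x"]) (auto intro!: exp_polys.intros has_vector_derivative_add)
next
  case (mult f g)
  then obtain f' g' where fg: "f' \<in> exp_polys" "g' \<in> exp_polys"
    "\<forall>x. ((\<lambda>t. f (x + t *\<^sub>R axis i 1)) has_vector_derivative f' x) (at 0)"
    "\<forall>x. ((\<lambda>t. g (x + t *\<^sub>R axis i 1)) has_vector_derivative g' x) (at 0)" by blast
  have "((\<lambda>t. f (x + t *\<^sub>R axis i 1) * g (x + t *\<^sub>R axis i 1)) has_vector_derivative f x * g' x + f' x * g x) (at 0)" for x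
    using has_vector_derivative_mult[OF fg(3)[rule_format, of x] fg(4)[rule_format, of x]] by simp
  with fg mult.hyps show ?case
    by (intro bexI[of _ "\<lambda>x. f x * g' x + f' x * g x"]) (auto intro!: exp_polys.intros)
qed

lemma has_partial:
  assumes "f \<in> exp_polys"
  shows "((\<lambda>t. f (x + t *\<^sub>R axis i 1)) has_vector_derivative pderiv_at i f x) (at 0)"
  using exp_polys_partial[OF assms, of i] unfolding pderiv_at_def by (metis vector_derivative_at)

lemma pderiv_at_eqI:
  "(\<And>x. ((\<lambda>t. f (x + t *\<^sub>R axis i 1)) has_vector_derivative g x) (at 0)) \<Longrightarrow> pderiv_at i f = g"
  unfolding pderiv_at_def by (rule ext) (rule vector_derivative_at)

lemma exp_polys_pderiv_at: "f \<in> exp_polys \<Longrightarrow> pderiv_at i f \<in> exp_polys"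
  using exp_polys_partial[of f i] by (metis pderiv_at_eqI)

lemma exp_polys_pderivs: "f \<in> exp_polys \<Longrightarrow> pderivs is f \<in> exp_polys"
  by (induction "is") (auto intro: exp_polys_pderiv_at)

lemma pderiv_at_const [simp]: "pderiv_at i (\<lambda>_. c) = (\<lambda>_. 0)"
  by (rule pderiv_at_eqI) simp

lemma pderiv_at_coord [simp]: "pderiv_at i (\<lambda>x. complex_of_real (x $ b)) = (\<lambda>_. if i = b then 1 else 0)"
  by (rule pderiv_at_eqI) (rule has_partial_coord)

lemma pderiv_at_cexp [simp]: "pderiv_at i (cexp \<zeta>) = (\<lambda>x. \<zeta> $ i * cexp \<zeta> x)"
  by (rule pderiv_at_eqI) (rule has_partial_cexp)

lemma pderiv_at_add:
  assumes "f \<in> exp_polys" "g \<in> exp_polys"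
  shows "pderiv_at i (\<lambda>x. f x + g x) = (\<lambda>x. pderiv_at i f x + pderiv_at i g x)"
  by (intro pderiv_at_eqI has_vector_derivative_add has_partial assms)

lemma pderiv_at_mult:
  assumes "f \<in> exp_polys" "g \<in> exp_polys"
  shows "pderiv_at i (\<lambda>x. f x * g x) = (\<lambda>x. f x * pderiv_at i g x + pderiv_at i f x * g x)"
  using has_vector_derivative_mult[OF has_partial has_partial, OF assms] by (intro pderiv_at_eqI) simp

lemma pderiv_at_cmult: "f \<in> exp_polys \<Longrightarrow> pderiv_at i (\<lambda>x. c * f x) = (\<lambda>x. c * pderiv_at i f x)"
  by (simp add: pderiv_at_mult exp_polys.const)

text \<open>Induction over the generation of the class takes the place of Schwarz's theorem:
  generators are computed directly, and the twofold Leibniz rule is symmetric in \<open>i\<close>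
  and \<open>j\<close> once the derivatives of the factors commute.\<close>

lemma pderiv_at_commute: "f \<in> exp_polys \<Longrightarrow> pderiv_at i (pderiv_at j f) = pderiv_at j (pderiv_at i f)"
proof (induction rule: exp_polys.induct)
  case (cexp \<zeta>)
  then show ?case by (simp add: pderiv_at_cmult exp_polys.cexp mult.left_commute)
next
  case (add f g)
  then show ?case by (simp add: pderiv_at_add exp_polys_pderiv_at)
next
  case (mult f g)
  then show ?case
    by (simp add: pderiv_at_add pderiv_at_mult exp_polys_pderiv_at exp_polys.mult algebra_simps)
qed auto

section \<open>Lipschitz and Hoelder bounds on bounded sets\<close>

lemma exp_polys_lipschitz_on_bounded:
  assumes "f \<in> exp_polys" "bounded S"
  shows "\<exists>L. L-lipschitz_on S f"
  using assms(1)
proof induction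
  case (const c)
  show ?case using lipschitz_on_constant by blast
next
  case (coord i)
  show ?case
    by (rule exI[of _ 1], rule lipschitz_onI)
      (auto simp: dist_norm component_le_norm_cart simp flip: of_real_diff vector_minus_component)
next
  case (cexp \<zeta>)
  define l where "l x = (\<Sum>i\<in>UNIV. \<zeta> $ i * of_real (x $ i))" for x :: "real^'a"
  have "linear l"
    by (rule linearI) (auto simp: l_def algebra_simps sum.distrib sum_distrib_left scaleR_conv_of_real[where 'a=complex])
  then have bl: "bounded_linear l" by (rule linear_conv_bounded_linear[THEN iffD1])
  then obtain B where B: "\<And>x. norm (l x) \<le> norm x * B" "0 < B"
    using bounded_linear.pos_bounded by blast
  obtain R where R: "\<And>x. x \<in> S \<Longrightarrow> norm x \<le> R"
    using assms(2) bounded_iff by blast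
  have "norm (cexp \<zeta> x - cexp \<zeta> y) \<le> (exp (R * B) * B) * dist x y" if "x \<in> S" "y \<in> S" for x y
  proof -
    have m: "l z \<in> cball 0 (R * B)" if "z \<in> S" for z
      using order_trans[OF B(1)[of z] mult_right_mono[OF R[OF that], of B]] B(2) by simp
    \<comment> \<open>The mean value inequality needs a convex domain, which \<open>S\<close> need
      not be. It is applied on a disc in the complex plane that contains the image of
      \<open>S\<close> under the linear exponent \<open>l\<close>.\<close>
    have "norm (exp (l x) - exp (l y)) \<le> exp (R * B) * norm (l x - l y)"
    proof (rule field_differentiable_bound[of "cball 0 (R * B)" exp exp])
      show "norm (exp z) \<le> exp (R * B)" if "z \<in> cball 0 (R * B)" for z :: complex
        using norm_exp[of z] that by (metis dist_0_norm exp_le_cancel_iff mem_cball order_trans)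
    qed (use m that in \<open>auto intro: DERIV_subset[OF DERIV_exp]\<close>)
    also have "norm (l x - l y) \<le> dist x y * B"
      using B(1)[of "x - y"] \<open>linear l\<close> by (simp add: linear_diff dist_norm)
    finally show ?thesis unfolding cexp_def l_def by (simp add: mult_ac)
  qed
  then show ?case
    by (intro exI[of _ "exp (R * B) * B"] lipschitz_onI) (use B in \<open>auto simp: dist_norm\<close>)
next
  case (add f g)
  then show ?case using lipschitz_on_add by blast
next
  case (mult f g)
  then obtain L M where LM: "L-lipschitz_on S f" "M-lipschitz_on S g" by blast
  \<comment> \<open>The product estimate needs uniform bounds on both factors; a Lipschitz image of
    a bounded set is bounded.\<close>
  have "bounded (f ` S)" "bounded (g ` S)"
    using LM assms(2) by (auto intro: bounded_uniformly_continuous_image lipschitz_on_uniformly_continuous)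
  then obtain P Q where PQ: "P > 0" "Q > 0" "\<And>x. x \<in> S \<Longrightarrow> norm (f x) \<le> P" "\<And>x. x \<in> S \<Longrightarrow> norm (g x) \<le> Q"
    unfolding bounded_pos by auto
  note nn = lipschitz_on_nonneg[OF LM(1)] lipschitz_on_nonneg[OF LM(2)]
  have "norm (f x * g x - f y * g y) \<le> (P * M + Q * L) * dist x y" if xy: "x \<in> S" "y \<in> S" for x y
  proof -
    have "f x * g x - f y * g y = f x * (g x - g y) + g y * (f x - f y)" by (simp add: algebra_simps)
    then have "norm (f x * g x - f y * g y) \<le> norm (f x) * norm (g x - g y) + norm (g y) * norm (f x - f y)"
      by (metis norm_mult norm_triangle_ineq)
    also have "\<dots> \<le> P * (M * dist x y) + Q * (L * dist x y)"
      using lipschitz_onD[OF LM(1) xy] lipschitz_onD[OF LM(2) xy] PQ nn xy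
      by (intro add_mono mult_mono) (auto simp: dist_norm)
    finally show ?thesis by (simp add: algebra_simps)
  qed
  then show ?case
    by (intro exI[of _ "P * M + Q * L"] lipschitz_onI) (use PQ nn in \<open>auto simp: dist_norm\<close>)
qed

lemma exp_polys_continuous_on:
  assumes "f \<in> exp_polys"
  shows "continuous_on S f"
  using assms
proof induction
  case (cexp \<zeta>)
  show ?case unfolding cexp_def[abs_def] by (intro continuous_intros)
qed (auto intro!: continuous_intros)

text \<open>Every partial derivative is continuous on the whole space, so it is its own extension to
  the closure, and it is Lipschitz on the bounded set, which is stronger than Hoelder there.\<close>

lemma exp_polys_holder_space:
  assumes f: "f \<in> exp_polys" and \<Omega>: "bounded \<Omega>" and \<alpha>: "0 < \<alpha>" "\<alpha> < 1"
  shows "f \<in> holder_space k \<alpha> \<Omega>"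
proof -
  note p = exp_polys_pderivs[OF f]
  have "\<exists>C. \<forall>x\<in>\<Omega>. \<forall>y\<in>\<Omega>. norm (pderivs is f x - pderivs is f y) \<le> C * dist x y powr \<alpha>" for "is"
  proof -
    obtain L where L: "L-lipschitz_on \<Omega> (pderivs is f)"
      using exp_polys_lipschitz_on_bounded[OF p \<Omega>] by blast
    obtain d where d: "\<And>x y. x \<in> \<Omega> \<Longrightarrow> y \<in> \<Omega> \<Longrightarrow> dist x y \<le> d"
      using diameter_bounded_bound[OF \<Omega>] by blast
    have "norm (pderivs is f x - pderivs is f y) \<le> (L * d powr (1 - \<alpha>)) * dist x y powr \<alpha>"
      if xy: "x \<in> \<Omega>" "y \<in> \<Omega>" for x y
    proof -
      have "norm (pderivs is f x - pderivs is f y) \<le> L * dist x y"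
        using lipschitz_onD[OF L xy] by (simp add: dist_norm)
      \<comment> \<open>The spare power \<open>1 - \<alpha>\<close> of the distance is positive and
        is absorbed into the constant through the bound \<open>d\<close> on distances in
        \<Omega>.\<close>
      also have "dist x y = dist x y powr (1 - \<alpha>) * dist x y powr \<alpha>"
        by (simp flip: powr_add)
      also have "\<dots> \<le> d powr (1 - \<alpha>) * dist x y powr \<alpha>"
        using \<alpha> d[OF xy] by (intro mult_right_mono powr_mono2) auto
      finally show ?thesis using lipschitz_on_nonneg[OF L] by (simp add: mult_left_mono mult.assoc)
    qed
    then show ?thesis by blast
  qed
  moreover have "Ck_on k \<Omega> f"
    unfolding Ck_on_def using has_partial[OF p, THEN differentiableI_vector] exp_polys_continuous_on[OF p]
    by blast
  ultimately show ?thesis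
    unfolding holder_space_def using exp_polys_continuous_on[OF p] exp_polys_continuous_on[OF f] by blast
qed

subsection \<open>Uniqueness for the Fourier transform on a bounded open set\<close>

lemma LinftyI_continuous:
  assumes "open \<Omega>" "bounded \<Omega>" "continuous_on (closure \<Omega>) g"
  shows "g \<in> Linfty \<Omega>"
proof -
  have "compact (g ` closure \<Omega>)"
    using assms by (intro compact_continuous_image) auto
  then obtain C where "\<And>x. x \<in> closure \<Omega> \<Longrightarrow> norm (g x) \<le> C"
    using compact_imp_bounded bounded_iff by (metis imageI)
  then have "AE x in lebesgue_on \<Omega>. norm (g x) \<le> C"
    using closure_subset by (intro AE_I2) auto
  moreover have "continuous_on \<Omega> g"
    using assms(3) closure_subset continuous_on_subset by blast
  ultimately show ?thesis
    unfolding Linfty_def using assms(1) by (auto intro: continuous_imp_measurable_on_sets_lebesgue)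
qed

lemma Linfty_mult:
  assumes "f \<in> Linfty \<Omega>" "g \<in> Linfty \<Omega>"
  shows "(\<lambda>x. f x * g x) \<in> Linfty \<Omega>"
proof -
  obtain C D where CD: "AE x in lebesgue_on \<Omega>. norm (f x) \<le> C" "AE x in lebesgue_on \<Omega>. norm (g x) \<le> D"
    using assms unfolding Linfty_def by blast
  have "AE x in lebesgue_on \<Omega>. norm (f x * g x) \<le> \<bar>C\<bar> * \<bar>D\<bar>"
    using CD by eventually_elim (auto simp: norm_mult intro!: mult_mono)
  then show ?thesis
    using assms unfolding Linfty_def by auto
qed

lemma Linfty_mult_continuous:
  assumes "open \<Omega>" "bounded \<Omega>" "f \<in> Linfty \<Omega>" "continuous_on (closure \<Omega>) g"
  shows "(\<lambda>x. f x * g x) \<in> Linfty \<Omega>"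
  by (rule Linfty_mult[OF assms(3) LinftyI_continuous[OF assms(1,2,4)]])

lemma Linfty_integrable:
  assumes "open \<Omega>" "bounded \<Omega>" "f \<in> Linfty \<Omega>"
  shows "integrable (lebesgue_on \<Omega>) f"
proof -
  have "\<Omega> \<in> lmeasurable" using assms by (simp add: lmeasurable_open)
  then interpret finite_measure "lebesgue_on \<Omega>" by (rule finite_measure_lebesgue_on)
  show ?thesis using assms(3) integrable_const_bound unfolding Linfty_def by blast
qed

text \<open>Bounded functions whose extension by zero has vanishing Fourier transform. The goal is
  that they vanish almost everywhere.\<close>

definition fourier_null :: "(real^'n::finite) set \<Rightarrow> (real^'n \<Rightarrow> complex) set" where
  "fourier_null \<Omega> = {f \<in> Linfty \<Omega>. \<forall>\<eta>. (LINT x|lebesgue_on \<Omega>. f x * cis (\<eta> \<bullet> x)) = 0}"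

text \<open>The real functions whose multiplication operator preserves \<open>fourier_null \<Omega>\<close> form an algebra
  containing all \<open>cos (\<eta> \<bullet> x + t)\<close>, so the Stone--Weierstrass theorem applies to it.\<close>

lemma fourier_null_mult_cos:
  assumes \<Omega>: "open \<Omega>" "bounded \<Omega>" and f: "f \<in> fourier_null \<Omega>"
  shows "(\<lambda>x. f x * of_real (cos (\<xi> \<bullet> x + t))) \<in> fourier_null \<Omega>"
proof -
  have fL: "f \<in> Linfty \<Omega>" and f0: "\<And>\<eta>. (LINT x|lebesgue_on \<Omega>. f x * cis (\<eta> \<bullet> x)) = 0"
    using f by (auto simp: fourier_null_def)
  have int: "integrable (lebesgue_on \<Omega>) (\<lambda>x. f x * cis (\<eta> \<bullet> x))" for \<eta>
    by (intro Linfty_integrable Linfty_mult_continuous \<Omega> fL) (auto intro!: continuous_intros)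
  \<comment> \<open>By Euler's formula a cosine factor only shifts the frequency \<eta> by \<xi> in
    both directions, so the new integral is a combination of two that vanish.\<close>
  have "of_real (cos s) * cis u = cis s / 2 * cis u + cis (-s) / 2 * cis u" for s u
    by (auto simp: complex_eq_iff field_simps)
  then have "f x * of_real (cos (\<xi> \<bullet> x + t)) * cis (\<eta> \<bullet> x) =
      cis t / 2 * (f x * cis ((\<eta> + \<xi>) \<bullet> x)) + cis (-t) / 2 * (f x * cis ((\<eta> - \<xi>) \<bullet> x))" for \<eta> x
    by (simp add: inner_add_left inner_diff_left mult.assoc cis_mult algebra_simps)
  then have "(LINT x|lebesgue_on \<Omega>. f x * of_real (cos (\<xi> \<bullet> x + t)) * cis (\<eta> \<bullet> x)) = 0" for \<eta>
    using int f0 by simp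
  then show ?thesis unfolding fourier_null_def
    using \<Omega> fL by (auto intro!: Linfty_mult_continuous continuous_intros)
qed

lemma fourier_null_mult_continuous:
  fixes g :: "real^'n::finite \<Rightarrow> real"
  assumes \<Omega>: "open \<Omega>" "bounded \<Omega>" and f: "f \<in> fourier_null \<Omega>" and g: "continuous_on (closure \<Omega>) g"
  shows "(LINT x|lebesgue_on \<Omega>. f x * of_real (g x)) = 0"
proof -
  \<comment> \<open>Quantifying over all of \<open>fourier_null \<Omega>\<close> and not only the
    given \<open>f\<close> makes \<open>R\<close> closed under products: one multiplier is applied
    after the other.\<close>
  define R where "R = {g. continuous_on (closure \<Omega>) g \<and>
    (\<forall>f\<in>fourier_null \<Omega>. (\<lambda>x. f x * complex_of_real (g x)) \<in> fourier_null \<Omega>)}"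
  interpret function_ring_on R "closure \<Omega>"
  proof
    show "compact (closure \<Omega>)" using \<Omega> by simp
    show "continuous_on (closure \<Omega>) h" if "h \<in> R" for h using that by (simp add: R_def)
    show "(\<lambda>_. c) \<in> R" for c
    proof -
      have "(\<lambda>x. f x * of_real c) \<in> fourier_null \<Omega>" if f: "f \<in> fourier_null \<Omega>" for f
      proof -
        have eq: "f x * of_real c * cis (\<eta> \<bullet> x) = of_real c * (f x * cis (\<eta> \<bullet> x))" for \<eta> x by simp
        have "(LINT x|lebesgue_on \<Omega>. f x * of_real c * cis (\<eta> \<bullet> x)) = 0" for \<eta>
          unfolding eq integral_mult_right_zero using f by (simp add: fourier_null_def)
        then show ?thesis using f unfolding fourier_null_def
          by (auto intro!: Linfty_mult_continuous \<Omega>)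
      qed
      then show ?thesis by (simp add: R_def)
    qed
    show "(\<lambda>x. h x * k x) \<in> R" if "h \<in> R" "k \<in> R" for h k
    proof -
      have "(\<lambda>x. f x * complex_of_real (h x * k x)) \<in> fourier_null \<Omega>" if f: "f \<in> fourier_null \<Omega>" for f
      proof -
        have "(\<lambda>x. f x * of_real (h x) * of_real (k x)) \<in> fourier_null \<Omega>"
          using f \<open>h \<in> R\<close> \<open>k \<in> R\<close> unfolding R_def by fast
        then show ?thesis by (simp add: mult.assoc)
      qed
      then show ?thesis using that by (auto simp: R_def intro: continuous_on_mult)
    qed
    show "(\<lambda>x. h x + k x) \<in> R" if hk: "h \<in> R" "k \<in> R" for h k
    proof -
      have c: "continuous_on (closure \<Omega>) h" "continuous_on (closure \<Omega>) k" using hk by (auto simp: R_def)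
      have "(\<lambda>x. f x * complex_of_real (h x + k x)) \<in> fourier_null \<Omega>" if f: "f \<in> fourier_null \<Omega>" for f
      proof -
        have fL: "f \<in> Linfty \<Omega>" using f by (simp add: fourier_null_def)
        have i: "integrable (lebesgue_on \<Omega>) (\<lambda>x. f x * of_real (u x) * cis (\<eta> \<bullet> x))"
          if "continuous_on (closure \<Omega>) u" for u \<eta>
          by (intro Linfty_integrable Linfty_mult_continuous \<Omega> fL) (auto intro!: continuous_intros that)
        have "f x * complex_of_real (h x + k x) * cis (\<eta> \<bullet> x)
          = f x * of_real (h x) * cis (\<eta> \<bullet> x) + f x * of_real (k x) * cis (\<eta> \<bullet> x)" for \<eta> x
          by (simp add: algebra_simps)
        moreover have "(LINT x|lebesgue_on \<Omega>. f x * of_real (h x) * cis (\<eta> \<bullet> x)) = 0"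
          "(LINT x|lebesgue_on \<Omega>. f x * of_real (k x) * cis (\<eta> \<bullet> x)) = 0" for \<eta>
          using f hk unfolding R_def fourier_null_def by blast+
        ultimately have "(LINT x|lebesgue_on \<Omega>. f x * complex_of_real (h x + k x) * cis (\<eta> \<bullet> x)) = 0" for \<eta>
          by (simp add: i c)
        then show ?thesis using fL c unfolding fourier_null_def
          by (auto intro!: Linfty_mult_continuous \<Omega> continuous_intros simp del: of_real_add)
      qed
      then show ?thesis using c by (auto simp: R_def intro: continuous_on_add)
    qed
    show "\<exists>h\<in>R. h x \<noteq> h y" if "x \<in> closure \<Omega>" "y \<in> closure \<Omega>" "x \<noteq> y" for x y
    proof (rule bexI)
      \<comment> \<open>Frequency and phase are chosen so that the argument of the cosine is 0 at
        \<open>x\<close> and \<open>pi\<close> at \<open>y\<close>, with values 1 and -1.\<close>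
      define \<xi> where "\<xi> = (pi / ((y - x) \<bullet> (y - x))) *\<^sub>R (y - x)"
      have "\<xi> \<bullet> y - \<xi> \<bullet> x = pi"
        using that unfolding inner_diff_right[symmetric] by (simp add: \<xi>_def)
      then show "cos (\<xi> \<bullet> x + (- (\<xi> \<bullet> x))) \<noteq> cos (\<xi> \<bullet> y + (- (\<xi> \<bullet> x)))" by simp
      show "(\<lambda>z. cos (\<xi> \<bullet> z + (- (\<xi> \<bullet> x)))) \<in> R"
        unfolding R_def mem_Collect_eq
        by (intro conjI ballI fourier_null_mult_cos[OF \<Omega>] continuous_intros)
    qed
  qed
  have fL: "f \<in> Linfty \<Omega>" using f by (simp add: fourier_null_def)
  have i: "integrable (lebesgue_on \<Omega>) (\<lambda>x. f x * of_real (u x))" if "continuous_on (closure \<Omega>) u" for u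
    by (intro Linfty_integrable Linfty_mult_continuous \<Omega> fL) (auto intro!: continuous_intros that)
  have ni: "integrable (lebesgue_on \<Omega>) (\<lambda>x. norm (f x))"
    using Linfty_integrable[OF \<Omega> fL] by simp
  define I where "I = (LINT x|lebesgue_on \<Omega>. norm (f x))"
  have "I \<ge> 0" unfolding I_def by (rule integral_nonneg_AE) simp
  have bound: "norm (LINT x|lebesgue_on \<Omega>. f x * of_real (g x)) \<le> e * I" if "e > 0" for e
  proof -
    obtain h where h: "h \<in> R" "\<And>x. x \<in> closure \<Omega> \<Longrightarrow> \<bar>g x - h x\<bar> < e"
      using Stone_Weierstrass_basic[OF g \<open>e > 0\<close>] by blast
    have hc: "continuous_on (closure \<Omega>) h" and "(\<lambda>x. f x * of_real (h x)) \<in> fourier_null \<Omega>"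
      using h f by (auto simp: R_def)
    \<comment> \<open>Frequency 0 turns the Fourier condition into the plain integral against
      \<open>h\<close>.\<close>
    then have "(LINT x|lebesgue_on \<Omega>. f x * of_real (h x) * cis (0 \<bullet> x)) = 0"
      unfolding fourier_null_def by blast
    then have "(LINT x|lebesgue_on \<Omega>. f x * of_real (g x)) = (LINT x|lebesgue_on \<Omega>. f x * of_real (g x) - f x * of_real (h x))"
      by (simp add: Bochner_Integration.integral_diff[OF i[OF g] i[OF hc]])
    also have "norm \<dots> \<le> (LINT x|lebesgue_on \<Omega>. norm (f x * of_real (g x) - f x * of_real (h x)))"
      by (rule integral_norm_bound)
    also have "\<dots> \<le> (LINT x|lebesgue_on \<Omega>. e * norm (f x))"
    proof (rule integral_mono)
      fix x assume "x \<in> space (lebesgue_on \<Omega>)"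
      then have "\<bar>g x - h x\<bar> \<le> e" using h(2)[of x] closure_subset by fastforce
      then have "norm (f x) * \<bar>g x - h x\<bar> \<le> norm (f x) * e" by (intro mult_left_mono) auto
      moreover have "f x * of_real (g x) - f x * of_real (h x) = f x * of_real (g x - h x)"
        by (simp add: algebra_simps)
      ultimately show "norm (f x * of_real (g x) - f x * of_real (h x)) \<le> e * norm (f x)"
        by (simp only: norm_mult norm_of_real mult.commute[of e] real_norm_def)
    next
      show "integrable (lebesgue_on \<Omega>) (\<lambda>x. norm (f x * of_real (g x) - f x * of_real (h x)))"
        by (intro integrable_norm Bochner_Integration.integrable_diff i g hc)
      show "integrable (lebesgue_on \<Omega>) (\<lambda>x. e * norm (f x))"
        by (intro integrable_mult_right ni)
    qed
    finally show ?thesis by (simp add: I_def)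
  qed
  have le: "norm (LINT x|lebesgue_on \<Omega>. f x * of_real (g x)) \<le> e" if "e > 0" for e
  proof -
    \<comment> \<open>The denominator is \<open>I + 1\<close> because \<open>I\<close> may be
      0.\<close>
    have "norm (LINT x|lebesgue_on \<Omega>. f x * of_real (g x)) \<le> e / (I + 1) * I"
      using \<open>I \<ge> 0\<close> that by (intro bound) simp
    also have "\<dots> \<le> e" using \<open>I \<ge> 0\<close> that by (simp add: field_simps)
    finally show ?thesis .
  qed
  have "norm (LINT x|lebesgue_on \<Omega>. f x * of_real (g x)) \<le> 0"
    by (rule field_le_epsilon) (simp add: le)
  then show ?thesis by simp
qed

text \<open>\<open>f\<close> is tested against itself: continuous functions converge to it almost
  everywhere, and dominated convergence exhibits the integral of \<open>f x * f x\<close> as a limit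
  of zeros.\<close>

lemma AE_zero_if_orthogonal_to_continuous:
  fixes f :: "real^'n::finite \<Rightarrow> real"
  assumes \<Omega>: "open \<Omega>" "bounded \<Omega>" and f: "f \<in> borel_measurable (lebesgue_on \<Omega>)"
    and C: "AE x in lebesgue_on \<Omega>. \<bar>f x\<bar> \<le> C"
    and orth: "\<And>g. continuous_on UNIV g \<Longrightarrow> (LINT x|lebesgue_on \<Omega>. f x * g x) = 0"
  shows "AE x in lebesgue_on \<Omega>. f x = 0"
proof -
  have "\<Omega> \<in> lmeasurable" using \<Omega> by (simp add: lmeasurable_open)
  then interpret finite_measure "lebesgue_on \<Omega>" by (rule finite_measure_lebesgue_on)
  have "f measurable_on \<Omega>"
    using f \<Omega> by (simp add: measurable_on_iff_borel_measurable)
  then obtain N g where N: "negligible N" and g: "\<And>n. continuous_on UNIV (g n)"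
    and lim: "\<And>x. x \<notin> N \<Longrightarrow> (\<lambda>n. g n x) \<longlonglongrightarrow> (if x \<in> \<Omega> then f x else 0)"
    unfolding measurable_on_def by blast
  \<comment> \<open>Truncation supplies a constant dominating function on a space of finite measure,
    and leaves the limit unchanged because \<open>f\<close> is itself bounded by \<open>C\<close>
    almost everywhere.\<close>
  define h where "h n x = max (-C) (min C (g n x))" for n :: nat and x
  have hc: "continuous_on UNIV (h n)" for n
    unfolding h_def by (intro continuous_intros g)
  have hm: "h n \<in> borel_measurable (lebesgue_on \<Omega>)" for n
    using hc \<Omega> by (intro continuous_imp_measurable_on_sets_lebesgue continuous_on_subset[OF hc]) auto
  have notN: "AE x in lebesgue_on \<Omega>. x \<notin> N"
    using N \<Omega> by (auto simp: AE_restrict_space_iff negligible_iff_null_sets intro: AE_not_in AE_mp)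
  have "(\<lambda>n. LINT x|lebesgue_on \<Omega>. f x * h n x) \<longlonglongrightarrow> (LINT x|lebesgue_on \<Omega>. f x * f x)"
  proof (rule integral_dominated_convergence[where w = "\<lambda>_. \<bar>C\<bar> * \<bar>C\<bar>"])
    show "AE x in lebesgue_on \<Omega>. (\<lambda>n. f x * h n x) \<longlonglongrightarrow> f x * f x"
      using notN C AE_space
    proof eventually_elim
      case (elim x)
      then have "(\<lambda>n. h n x) \<longlonglongrightarrow> max (-C) (min C (f x))"
        unfolding h_def using lim[of x] by (intro tendsto_intros) auto
      moreover have "max (-C) (min C (f x)) = f x" using elim by auto
      ultimately show ?case by (auto intro: tendsto_intros)
    qed
    show "AE x in lebesgue_on \<Omega>. norm (f x * h n x) \<le> \<bar>C\<bar> * \<bar>C\<bar>" for n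
      using C by eventually_elim (auto simp: abs_mult h_def intro!: mult_mono)
  qed (use f hm in auto)
  then have "(LINT x|lebesgue_on \<Omega>. f x * f x) = 0"
    by (simp add: orth[OF hc] LIMSEQ_const_iff)
  moreover have "integrable (lebesgue_on \<Omega>) (\<lambda>x. f x * f x)"
  proof (rule integrable_const_bound)
    show "AE x in lebesgue_on \<Omega>. norm (f x * f x) \<le> \<bar>C\<bar> * \<bar>C\<bar>"
      using C
    proof eventually_elim
      case (elim x)
      then have "\<bar>f x\<bar> * \<bar>f x\<bar> \<le> \<bar>C\<bar> * \<bar>C\<bar>" by (intro mult_mono) auto
      then show ?case by (simp only: real_norm_def abs_mult)
    qed
  qed (use f in auto)
  ultimately have "AE x in lebesgue_on \<Omega>. f x * f x = 0"
    by (subst (asm) integral_nonneg_eq_0_iff_AE) auto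
  then show ?thesis by simp
qed

text \<open>Against real weights, the real and imaginary parts of the integral are the integrals of
  the real and imaginary parts of \<open>f\<close>, so the real criterion applies to each.\<close>

lemma fourier_null_AE_zero:
  assumes \<Omega>: "open \<Omega>" "bounded \<Omega>" and f: "f \<in> fourier_null \<Omega>"
  shows "AE x in lebesgue_on \<Omega>. f x = 0"
proof -
  have fL: "f \<in> Linfty \<Omega>" using f by (simp add: fourier_null_def)
  then obtain C where C: "AE x in lebesgue_on \<Omega>. norm (f x) \<le> C"
    and fm: "f \<in> borel_measurable (lebesgue_on \<Omega>)" unfolding Linfty_def by blast
  have *: "(LINT x|lebesgue_on \<Omega>. Re (f x) * g x) = 0 \<and> (LINT x|lebesgue_on \<Omega>. Im (f x) * g x) = 0"
    if g: "continuous_on UNIV g" for g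
  proof -
    have gc: "continuous_on (closure \<Omega>) g" using g continuous_on_subset by blast
    have "integrable (lebesgue_on \<Omega>) (\<lambda>x. f x * of_real (g x))"
      by (intro Linfty_integrable Linfty_mult_continuous \<Omega> fL) (auto intro!: continuous_intros gc)
    from integral_Re[OF this] integral_Im[OF this] show ?thesis
      by (simp add: fourier_null_mult_continuous[OF \<Omega> f gc])
  qed
  have "AE x in lebesgue_on \<Omega>. Re (f x) = 0"
  proof (rule AE_zero_if_orthogonal_to_continuous[OF \<Omega>])
    show "AE x in lebesgue_on \<Omega>. \<bar>Re (f x)\<bar> \<le> C"
      using C by eventually_elim (meson abs_Re_le_cmod order_trans)
  qed (use * fm in auto)
  moreover have "AE x in lebesgue_on \<Omega>. Im (f x) = 0"
  proof (rule AE_zero_if_orthogonal_to_continuous[OF \<Omega>])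
    show "AE x in lebesgue_on \<Omega>. \<bar>Im (f x)\<bar> \<le> C"
      using C by eventually_elim (meson abs_Im_le_cmod order_trans)
  qed (use * fm in auto)
  ultimately show ?thesis by eventually_elim (simp add: complex_eq_iff)
qed

text \<open>The set where \<open>f\<close> is nonzero is open by continuity and null by assumption,
  and a nonempty open set is never negligible.\<close>

lemma AE_zero_continuous_imp_zero:
  fixes f :: "real^'n::finite \<Rightarrow> complex"
  assumes \<Omega>: "open \<Omega>" and f: "continuous_on \<Omega> f" and ae: "AE x in lebesgue_on \<Omega>. f x = 0" and x: "x \<in> \<Omega>"
  shows "f x = 0"
proof -
  define U where "U = \<Omega> \<inter> f -` (- {0})"
  have U: "open U"
    unfolding U_def using continuous_open_preimage[OF f \<Omega> open_Compl[OF closed_singleton[of 0]]] .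
  have "AE x in lebesgue. x \<notin> U"
    using ae \<Omega> by (auto simp: AE_restrict_space_iff U_def elim: eventually_mono)
  then have "negligible U"
    using U AE_iff_null_sets[of U lebesgue] by (simp add: negligible_iff_null_sets)
  then have "U = {}" using U open_not_negligible by blast
  then show ?thesis using x by (auto simp: U_def)
qed

subsection \<open>Harmonic functions and commutators\<close>

lemma exp_polys_sum: "(\<And>i. i \<in> I \<Longrightarrow> f i \<in> exp_polys) \<Longrightarrow> (\<lambda>x. \<Sum>i\<in>I. f i x) \<in> exp_polys"
  by (induction I rule: infinite_finite_induct) (auto intro: exp_polys.intros)

lemma pderiv_at_sum:
  "(\<And>i. i \<in> I \<Longrightarrow> f i \<in> exp_polys) \<Longrightarrow>
    pderiv_at b (\<lambda>x. \<Sum>i\<in>I. f i x) = (\<lambda>x. \<Sum>i\<in>I. pderiv_at b (f i) x)"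
  by (induction I rule: infinite_finite_induct) (auto simp: pderiv_at_add exp_polys_sum)

lemma pderiv_at_coord_mult:
  assumes "h \<in> exp_polys"
  shows "pderiv_at i (\<lambda>x. of_real (x $ b) * h x) = (\<lambda>x. of_real (x $ b) * pderiv_at i h x + of_bool (i = b) * h x)"
  using pderiv_at_mult[OF exp_polys.coord assms, of i b] by (simp add: of_bool_def)

lemma neg_laplacian_coord_mult:
  assumes h: "h \<in> exp_polys"
  shows "neg_laplacian (\<lambda>x. of_real (x $ b) * h x) =
    (\<lambda>x. of_real (x $ b) * neg_laplacian h x - 2 * pderiv_at b h x)"
proof
  fix x
  note c = exp_polys.intros h exp_polys_pderiv_at
  have "pderivs [i, i] (\<lambda>x. of_real (x $ b) * h x) x =
      of_real (x $ b) * pderivs [i, i] h x + (if i = b then 2 * pderiv_at b h x else 0)" for i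
    by (simp add: c pderiv_at_coord_mult pderiv_at_add pderiv_at_cmult)
  then show "neg_laplacian (\<lambda>x. of_real (x $ b) * h x) x =
      of_real (x $ b) * neg_laplacian h x - 2 * pderiv_at b h x"
    by (simp add: neg_laplacian_def sum.distrib sum_distrib_left del: pderivs.simps)
qed

lemma neg_laplacian_pderiv_at:
  assumes h: "h \<in> exp_polys"
  shows "neg_laplacian (pderiv_at b h) = pderiv_at b (neg_laplacian h)"
proof
  fix x
  note [simp] = exp_polys.intros h exp_polys_pderiv_at
  have "neg_laplacian h = (\<lambda>x. (- 1) * (\<Sum>i\<in>UNIV. pderiv_at i (pderiv_at i h) x))"
    by (simp add: neg_laplacian_def fun_eq_iff)
  then have "pderiv_at b (neg_laplacian h) x = - (\<Sum>i\<in>UNIV. pderiv_at b (pderiv_at i (pderiv_at i h)) x)"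
    by (simp only: pderiv_at_cmult exp_polys_sum exp_polys_pderiv_at h pderiv_at_sum) simp
  also have "\<dots> = neg_laplacian (pderiv_at b h) x"
    by (simp add: neg_laplacian_def pderiv_at_commute[of _ b])
  finally show "neg_laplacian (pderiv_at b h) x = pderiv_at b (neg_laplacian h) x" ..
qed

lemma neg_laplacian_cmult: "f \<in> exp_polys \<Longrightarrow> neg_laplacian (\<lambda>x. c * f x) = (\<lambda>x. c * neg_laplacian f x)"
  by (simp add: neg_laplacian_def fun_eq_iff pderiv_at_cmult exp_polys_pderiv_at sum_distrib_left)

lemma neg_laplacian_add:
  "f \<in> exp_polys \<Longrightarrow> g \<in> exp_polys \<Longrightarrow>
    neg_laplacian (\<lambda>x. f x + g x) = (\<lambda>x. neg_laplacian f x + neg_laplacian g x)"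
  by (simp add: neg_laplacian_def fun_eq_iff pderiv_at_add exp_polys_pderiv_at sum.distrib)

text \<open>Harmonicity is required on the whole space, not only in \<Omega>: the Laplacian is then
  the zero function, and it can be differentiated or iterated by plain rewriting.\<close>

definition harmonics :: "(real^'n::finite \<Rightarrow> complex) set" where
  "harmonics = {h \<in> exp_polys. neg_laplacian h = (\<lambda>_. 0)}"

lemma biharmonic_harmonic: "h \<in> harmonics \<Longrightarrow> (neg_laplacian ^^ 2) h = (\<lambda>_. 0)"
  by (auto simp: harmonics_def numeral_2_eq_2 neg_laplacian_def)

text \<open>The commutator of \<open>neg_laplacian\<close> with a coordinate is -2 times a partial
  derivative, and partial derivatives preserve harmonicity because constant-coefficient operators
  commute.\<close>

lemma biharmonic_coord_mult:
  assumes "h \<in> harmonics"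
  shows "(neg_laplacian ^^ 2) (\<lambda>x. of_real (x $ b) * h x) = (\<lambda>_. 0)"
proof -
  have h: "h \<in> exp_polys" and h0: "neg_laplacian h = (\<lambda>_. 0)"
    using assms by (auto simp: harmonics_def)
  have "neg_laplacian (\<lambda>x. of_real (x $ b) * h x) = (\<lambda>x. (- 2) * pderiv_at b h x)"
    using neg_laplacian_coord_mult[OF h, of b] h0 by simp
  then show ?thesis
    using h h0 by (simp only: numeral_2_eq_2 funpow.simps o_apply id_apply)
      (simp add: neg_laplacian_cmult[where c = "- 2", simplified] neg_laplacian_pderiv_at exp_polys_pderiv_at)
qed

lemma harmonics_cexp:
  assumes "(\<Sum>i\<in>UNIV. \<zeta> $ i * \<zeta> $ i) = 0"
  shows "cexp \<zeta> \<in> harmonics"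
proof -
  have "neg_laplacian (cexp \<zeta>) x = - (\<Sum>i\<in>UNIV. \<zeta> $ i * \<zeta> $ i) * cexp \<zeta> x" for x
    by (simp add: neg_laplacian_def pderiv_at_cmult exp_polys.cexp sum_distrib_right mult.assoc)
  then show ?thesis using assms by (auto simp: harmonics_def exp_polys.cexp)
qed

section \<open>Harmonic polynomials of degree at most two\<close>

lemma harmonics_const: "(\<lambda>_. c) \<in> harmonics"
  by (simp add: harmonics_def exp_polys.const neg_laplacian_def fun_eq_iff)

lemma harmonics_coord: "(\<lambda>x. of_real (x $ i)) \<in> harmonics"
  by (simp add: harmonics_def exp_polys.coord neg_laplacian_def fun_eq_iff)

lemma harmonics_mult_coord: "k \<noteq> l \<Longrightarrow> (\<lambda>x. of_real (x $ k) * of_real (x $ l)) \<in> harmonics"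
  using harmonics_coord[of l]
  by (simp add: harmonics_def exp_polys.intros neg_laplacian_coord_mult)

lemma harmonics_diff_squares:
  \<comment> \<open>Both squares have the same Laplacian. The difference is spelled as a sum with a
    factor -1 to fit the derivative rules, which are those for sums and products.\<close>
  "(\<lambda>x. of_real (x $ k) * of_real (x $ k) + (- 1) * (of_real (x $ l) * of_real (x $ l))) \<in> harmonics"
proof -
  define sq where "sq i x = complex_of_real (x $ i) * of_real (x $ i)" for i and x :: "real^'a"
  have sq: "sq i \<in> exp_polys" "neg_laplacian (sq i) = (\<lambda>_. - 2)" for i
    using harmonics_coord[of i] exp_polys.intros
    by (auto simp: sq_def[abs_def] harmonics_def neg_laplacian_coord_mult)
  have "neg_laplacian (\<lambda>x. sq k x + (- 1) * sq l x) =
      (\<lambda>x. neg_laplacian (sq k) x + neg_laplacian (\<lambda>x. (- 1) * sq l x) x)"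
    by (rule neg_laplacian_add) (intro exp_polys.intros sq)+
  also have "\<dots> = (\<lambda>_. 0)"
    unfolding neg_laplacian_cmult[OF sq(1)] sq(2) by simp
  finally have "neg_laplacian (\<lambda>x. sq k x + (- 1) * sq l x) = (\<lambda>_. 0)" .
  moreover have "(\<lambda>x. sq k x + (- 1) * sq l x) \<in> exp_polys"
    by (intro exp_polys.intros sq)
  ultimately have "(\<lambda>x. sq k x + (- 1) * sq l x) \<in> harmonics"
    unfolding harmonics_def mem_Collect_eq by blast
  then show ?thesis by (simp only: sq_def)
qed

text \<open>Calderon's complex exponentials: the frequencies \<open>\<i> * \<eta> / 2\<close> plus
  and minus \<open>w\<close>, with \<open>w\<close> orthogonal to \<eta> and half as long, have
  vanishing sum of squares and add up to \<open>\<i> * \<eta>\<close>. Dimension at least two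
  provides a direction for \<open>w\<close>.\<close>

lemma harmonics_product_cis:
  fixes \<eta> :: "real^'n::finite"
  assumes "CARD('n) \<ge> 2"
  obtains g h where "g \<in> harmonics" "h \<in> harmonics" "\<And>x. g x * h x = cis (\<eta> \<bullet> x)"
proof -
  obtain y :: "real^'n" where y: "y \<noteq> 0" "\<eta> \<bullet> y = 0"
  proof (rule orthogonal_to_vector_exists[of \<eta>])
    show "2 \<le> DIM(real^'n)" using assms by simp
  qed (simp add: orthogonal_def)
  define w where "w = (norm \<eta> / (2 * norm y)) *\<^sub>R y"
  have w: "\<eta> \<bullet> w = 0" "w \<bullet> w = (\<eta> \<bullet> \<eta>) / 4"
  proof -
    show "\<eta> \<bullet> w = 0" using y by (simp add: w_def)
    have "w \<bullet> w = (norm \<eta> / (2 * norm y))\<^sup>2 * (norm y)\<^sup>2"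
      by (simp add: w_def dot_square_norm power2_eq_square)
    also have "\<dots> = (norm \<eta>)\<^sup>2 / 4"
      using y by (simp add: power_divide power_mult_distrib)
    finally show "w \<bullet> w = (\<eta> \<bullet> \<eta>) / 4" by (simp add: dot_square_norm)
  qed
  \<comment> \<open>\<open>s\<close> is the sign of \<open>w\<close>. In the sum of squares, the
    length of \<open>w\<close> cancels the real part, and its orthogonality to \<eta> the imaginary
    part.\<close>
  define \<zeta> where "\<zeta> s = (\<chi> i. \<i> * of_real (\<eta> $ i / 2) + of_real (s * w $ i))" for s
  have "\<zeta> s $ i * \<zeta> s $ i = of_real (s * s * (w $ i * w $ i) - (\<eta> $ i * \<eta> $ i) / 4) + \<i> * of_real (s * (\<eta> $ i * w $ i))" for s i
    by (simp add: \<zeta>_def complex_eq_iff)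
  then have "(\<Sum>i\<in>UNIV. \<zeta> s $ i * \<zeta> s $ i) =
      of_real (\<Sum>i\<in>UNIV. s * s * (w $ i * w $ i) - (\<eta> $ i * \<eta> $ i) / 4) + \<i> * of_real (\<Sum>i\<in>UNIV. s * (\<eta> $ i * w $ i))" for s
    by (simp only: sum.distrib of_real_sum sum_distrib_left)
  also have "\<dots> s = of_real (s * s * (w \<bullet> w) - (\<eta> \<bullet> \<eta>) / 4) + \<i> * of_real (s * (\<eta> \<bullet> w))" for s
    by (simp only: inner_vec_def inner_real_def sum_subtractf sum_distrib_left sum_divide_distrib)
  finally have null: "(\<Sum>i\<in>UNIV. \<zeta> s $ i * \<zeta> s $ i) = 0" if "s * s = 1" for s
    by (simp only: w that) simp
  have "cexp (\<zeta> 1) x * cexp (\<zeta> (-1)) x = cis (\<eta> \<bullet> x)" for x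
  proof -
    have "(\<Sum>i\<in>UNIV. \<zeta> 1 $ i * of_real (x $ i)) + (\<Sum>i\<in>UNIV. \<zeta> (-1) $ i * of_real (x $ i))
        = (\<Sum>i\<in>UNIV. \<i> * of_real (\<eta> $ i * x $ i))"
      unfolding sum.distrib[symmetric] by (intro sum.cong refl) (simp add: \<zeta>_def complex_eq_iff field_simps)
    also have "\<dots> = \<i> * of_real (\<eta> \<bullet> x)" by (simp add: inner_vec_def sum_distrib_left)
    finally show ?thesis by (simp add: cexp_def cis_conv_exp flip: exp_add)
  qed
  moreover have "cexp (\<zeta> 1) \<in> harmonics" "cexp (\<zeta> (-1)) \<in> harmonics"
    by (rule harmonics_cexp, rule null, simp)+
  ultimately show ?thesis by (rule that[rotated -1])
qed

text \<open>Products of two harmonic functions include every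
  \<open>cis (\<eta> \<bullet> x)\<close>, so \<open>f\<close> lies in
  \<open>fourier_null \<Omega>\<close>. This serves both the tensor fields and
  \<open>q\<close>.\<close>

lemma AE_zero_if_orthogonal_to_harmonic_products:
  fixes f :: "real^'n::finite \<Rightarrow> complex"
  assumes "CARD('n) \<ge> 2" "open \<Omega>" "bounded \<Omega>" "f \<in> Linfty \<Omega>"
    and "\<And>g h. g \<in> harmonics \<Longrightarrow> h \<in> harmonics \<Longrightarrow> (LINT x|lebesgue_on \<Omega>. f x * (g x * h x)) = 0"
  shows "AE x in lebesgue_on \<Omega>. f x = 0"
proof (rule fourier_null_AE_zero[OF assms(2,3)])
  have "(LINT x|lebesgue_on \<Omega>. f x * cis (\<eta> \<bullet> x)) = 0" for \<eta>
  proof -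
    obtain g h where "g \<in> harmonics" "h \<in> harmonics" and gh: "\<And>x. g x * h x = cis (\<eta> \<bullet> x)"
      using harmonics_product_cis[OF assms(1), of \<eta>] by blast
    then show ?thesis using assms(5)[of g h] by (simp only: gh)
  qed
  then show "f \<in> fourier_null \<Omega>" using assms(4) by (simp add: fourier_null_def)
qed

text \<open>Plain derivatives are used here; the powers of the imaginary unit that belong to
  \<open>D_op\<close> are put back in \<open>symbol\<close>.\<close>

definition coord_commutator :: "'n::finite \<Rightarrow> 'n list \<Rightarrow> (real^'n \<Rightarrow> complex) \<Rightarrow> real^'n \<Rightarrow> complex" where
  "coord_commutator b is h x = pderivs is (\<lambda>x. of_real (x $ b) * h x) x - of_real (x $ b) * pderivs is h x"

text \<open>By the Leibniz rule exactly one derivative falls on the coordinate, whose gradient is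
  constant. Each position of \<open>b\<close> in the index list contributes one term, with that
  position deleted.\<close>

lemma coord_commutator_simps:
  assumes "h \<in> exp_polys"
  shows "coord_commutator b [i] h x = of_bool (i = b) * h x"
    and "coord_commutator b [i, j] h x = of_bool (i = b) * pderiv_at j h x + of_bool (j = b) * pderiv_at i h x"
    and "coord_commutator b [i, j, k] h x =
      of_bool (i = b) * pderivs [j, k] h x + of_bool (j = b) * pderivs [i, k] h x + of_bool (k = b) * pderivs [i, j] h x"
proof -
  note c = assms exp_polys.intros exp_polys_pderiv_at
  note d = pderivs.simps coord_commutator_def pderiv_at_coord_mult pderiv_at_add pderiv_at_cmult c
  show "coord_commutator b [i] h x = of_bool (i = b) * h x"
    by (simp only: d) simp
  show "coord_commutator b [i, j] h x = of_bool (i = b) * pderiv_at j h x + of_bool (j = b) * pderiv_at i h x"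
    by (simp only: d) simp
  show "coord_commutator b [i, j, k] h x =
      of_bool (i = b) * pderivs [j, k] h x + of_bool (j = b) * pderivs [i, k] h x + of_bool (k = b) * pderivs [i, j] h x"
    by (simp only: d) simp
qed

section \<open>Sums over index lists and symmetric tensors\<close>

lemma sum_lists_Suc:
  "(\<Sum>is | length is = Suc n. f is) = (\<Sum>i\<in>(UNIV::'n::finite set). \<Sum>is | length is = n. f (i # is))"
proof -
  have "(\<Sum>i\<in>(UNIV::'n set). \<Sum>is | length is = n. f (i # is)) =
      (\<Sum>p\<in>(UNIV::'n set) \<times> {is. length is = n}. f (fst p # snd p))"
    by (simp add: sum.cartesian_product case_prod_unfold)
  also have "\<dots> = (\<Sum>is | length is = Suc n. f is)"
    by (rule sum.reindex_bij_witness[where i = "\<lambda>is. (hd is, tl is)" and j = "\<lambda>p. fst p # snd p"])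
      (auto simp: length_Suc_conv)
  finally show ?thesis ..
qed

lemma tensor_comp_cong:
  assumes "T \<in> sym_tensors j" "length is = j" "mset is = mset js"
  shows "tensor_comp T is = tensor_comp T js"
proof -
  have "\<forall>vs ws. length vs = j \<and> mset ws = mset vs \<longrightarrow> T ws = T vs"
    using assms(1) unfolding sym_tensors_def mem_Collect_eq by (rule conjunct2)
  moreover have "length js = j" "mset (map (\<lambda>i. axis i (1::real)) is) = mset (map (\<lambda>i. axis i 1) js)"
    using assms(2) mset_eq_length[OF assms(3)] assms(3) by (simp_all add: mset_map)
  ultimately show ?thesis unfolding tensor_comp_def by (metis length_map)
qed

text \<open>Multilinearity expands the arguments in the standard basis, one slot at a time.\<close>

lemma tensor_zeroI:
  assumes T: "T \<in> sym_tensors j" and zero: "\<And>is. length is = j \<Longrightarrow> tensor_comp T is = 0"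
  shows "tensor_zero j T"
proof -
  \<comment> \<open>The first \<open>m\<close> slots are arbitrary and the others hold basis
    vectors. Induction on \<open>m\<close> frees one more slot each time, and \<open>m = j\<close>
    is the claim.\<close>
  have "T vs = 0" if "length vs = j" "m \<le> j" "\<And>l. m \<le> l \<Longrightarrow> l < j \<Longrightarrow> vs ! l \<in> range (\<lambda>i. axis i 1)" for m vs
    using that
  proof (induction m arbitrary: vs)
    case 0
    then have "\<forall>v\<in>set vs. v \<in> range (\<lambda>i. axis i 1)" by (auto simp: in_set_conv_nth)
    then have "vs \<in> lists (range (\<lambda>i. axis i 1))" by auto
    then obtain "is" where "vs = map (\<lambda>i. axis i 1) is"
      unfolding lists_image by blast
    with 0 zero[of "is"] show ?case by (simp add: tensor_comp_def)
  next
    case (Suc m)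
    have lin: "linear (\<lambda>u. T (vs[m := u]))"
      using conjunct1[OF T[unfolded sym_tensors_def mem_Collect_eq], rule_format, of vs m] Suc.prems(1,2)
      by simp
    have z: "T (vs[m := axis i 1]) = 0" for i
      using Suc.prems by (intro Suc.IH) (auto simp: nth_list_update)
    have "vs ! m = (\<Sum>i\<in>UNIV. (vs ! m $ i) *\<^sub>R axis i 1)"
      using basis_expansion[of "vs ! m"] by (simp add: scalar_mult_eq_scaleR)
    then have "T (vs[m := vs ! m]) = (\<Sum>i\<in>UNIV. (vs ! m $ i) *\<^sub>R T (vs[m := axis i 1]))"
      using linear_sum[OF lin, of "\<lambda>i. (vs ! m $ i) *\<^sub>R axis i 1" UNIV] by (simp add: linear_scale[OF lin])
    then show ?case by (simp add: z)
  qed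
  from this[of _ j] show ?thesis unfolding tensor_zero_def by auto
qed

subsection \<open>The integral identity\<close>

text \<open>The two summands stay separate so that the second derivative of a square comes out as 2
  without a case distinction.\<close>

lemma pderivs_coord_coord:
  "pderivs [i, j] (\<lambda>x. complex_of_real (x $ k) * of_real (x $ l)) x =
    of_bool (i = k \<and> j = l) + of_bool (i = l \<and> j = k)"
proof -
  have "pderiv_at j (\<lambda>x. complex_of_real (x $ k) * of_real (x $ l)) =
      (\<lambda>x. of_bool (j = l) * of_real (x $ k) + of_bool (j = k) * of_real (x $ l))"
    by (simp add: pderiv_at_coord_mult exp_polys.coord fun_eq_iff)
  then show ?thesis
    by (simp add: pderiv_at_add pderiv_at_cmult exp_polys.intros of_bool_conj mult.commute)
qed

lemma pderivs_diff:
  assumes "f \<in> exp_polys" "g \<in> exp_polys"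
  shows "pderivs [i, j] (\<lambda>x. f x + (- 1) * g x) x = pderivs [i, j] f x - pderivs [i, j] g x"
  by (simp only: pderivs.simps pderiv_at_add pderiv_at_cmult exp_polys_pderiv_at exp_polys.intros assms) simp

lemma sum_sum_of_bool_mult:
  "(\<Sum>i\<in>UNIV. \<Sum>j\<in>UNIV. c i j * of_bool (i = k \<and> j = l)) = (c k l :: complex)"
  for k l :: "'n::finite"
proof -
  have "(\<Sum>j\<in>UNIV. c i j * of_bool (i = k \<and> j = l)) = (if i = k then c i l else 0)" for i
  proof -
    have "c i j * of_bool (i = k \<and> j = l) = (if j = l then if i = k then c i l else 0 else 0)" for j
      by simp
    then show ?thesis by simp
  qed
  then show ?thesis by simp
qed

locale integral_identity =
  fixes \<Omega> :: "(real^'n::finite) set"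
    and \<alpha> :: real
    and A :: "nat \<Rightarrow> real^'n \<Rightarrow> 'n tensor"
    and q :: "real^'n \<Rightarrow> complex"
  assumes card_ge_2: "CARD('n) \<ge> 2"
    and \<Omega>: "open \<Omega>" "bounded \<Omega>"
    and \<alpha>: "0 < \<alpha>" "\<alpha> < 1"
    and A: "\<And>j. j \<in> {1..3} \<Longrightarrow> A j \<in> cont_sym_tensor_fields j (closure \<Omega>)"
    and q: "q \<in> Linfty \<Omega>"
    and identity: "\<And>v :: nat \<Rightarrow> real^'n \<Rightarrow> complex.
      (\<And>l. l \<in> {0..2} \<Longrightarrow>
         v l \<in> holder_space 4 \<alpha> \<Omega> \<and> (\<forall>x\<in>\<Omega>. (neg_laplacian ^^ 2) (v l) x = 0)) \<Longrightarrow>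
      (\<Sum>j=1..3. \<Sum>is | length is = j.
         LINT x|lebesgue_on \<Omega>. tensor_comp (A j x) is *
           (v 1 x * D_op is (v 2) x + v 2 x * D_op is (v 1) x) * v 0 x)
      + (LINT x|lebesgue_on \<Omega>. q x * v 1 x * v 2 x * v 0 x) = 0"
begin

abbreviation "biharmonics \<equiv> {f \<in> exp_polys. (neg_laplacian ^^ 2) f = (\<lambda>_. 0)}"

lemma harmonic_biharmonics: "h \<in> harmonics \<Longrightarrow> h \<in> biharmonics"
  using biharmonic_harmonic by (auto simp: harmonics_def)

lemma coord_mult_biharmonics: "h \<in> harmonics \<Longrightarrow> (\<lambda>x. of_real (x $ b) * h x) \<in> biharmonics"
  using biharmonic_coord_mult by (auto simp: harmonics_def intro: exp_polys.intros)

text \<open>The indexed family is replaced by three named functions: \<open>f\<close> is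
  \<open>v 0\<close>, \<open>g\<close> is \<open>v 1\<close> and \<open>h\<close> is
  \<open>v 2\<close>. Hoelder regularity is automatic in \<open>exp_polys\<close>.\<close>

lemma identity3:
  assumes "f \<in> biharmonics" "g \<in> biharmonics" "h \<in> biharmonics"
  shows "(\<Sum>j=1..3. \<Sum>is | length is = j.
         LINT x|lebesgue_on \<Omega>. tensor_comp (A j x) is * (g x * D_op is h x + h x * D_op is g x) * f x)
      + (LINT x|lebesgue_on \<Omega>. q x * g x * h x * f x) = 0"
proof -
  \<comment> \<open>Indices above 2 also receive \<open>h\<close>, so the required properties hold
    for every index.\<close>
  define v where "v l = (if l = 0 then f else if l = 1 then g else h)" for l :: nat
  have "v l \<in> biharmonics" for l using assms by (simp add: v_def)
  then have "v l \<in> holder_space 4 \<alpha> \<Omega> \<and> (\<forall>x\<in>\<Omega>. (neg_laplacian ^^ 2) (v l) x = 0)" for l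
    using exp_polys_holder_space[OF _ \<Omega>(2) \<alpha>] by (metis (mono_tags, lifting) mem_Collect_eq)
  from identity[of v, OF this] show ?thesis by (simp add: v_def)
qed

section \<open>The commutator symbol and its vanishing\<close>

lemma tensor_comp_Linfty:
  assumes "j \<in> {1..3}" "length is = j"
  shows "(\<lambda>x. tensor_comp (A j x) is) \<in> Linfty \<Omega>"
  using A[OF assms(1)] assms(2) by (intro LinftyI_continuous \<Omega>) (auto simp: cont_sym_tensor_fields_def)

text \<open>The commutator of the whole differential operator with coefficients \<open>A\<close> and
  the coordinate \<open>x $ b\<close>, applied to \<open>h\<close>; \<open>1 / \<i> ^ j\<close> is
  the normalisation of \<open>D_op\<close>.\<close>

definition symbol :: "'n \<Rightarrow> (real^'n \<Rightarrow> complex) \<Rightarrow> real^'n \<Rightarrow> complex" where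
  "symbol b h x = (\<Sum>j=1..3. \<Sum>is | length is = j. tensor_comp (A j x) is * ((1 / \<i> ^ j) * coord_commutator b is h x))"

lemma continuous_on_coord_commutator:
  "h \<in> exp_polys \<Longrightarrow> continuous_on S (coord_commutator b is h)"
  unfolding coord_commutator_def
  by (intro continuous_intros exp_polys_continuous_on exp_polys_pderivs exp_polys.intros)

lemma continuous_on_symbol: "h \<in> exp_polys \<Longrightarrow> continuous_on (closure \<Omega>) (symbol b h)"
  unfolding symbol_def using A
  by (intro continuous_intros continuous_on_coord_commutator) (auto simp: cont_sym_tensor_fields_def)

text \<open>Moving the factor \<open>x $ b\<close> from one biharmonic function to another cancels \<open>q\<close> and every term
  in which the operators act on \<open>h\<close>; only the commutators of the operators with \<open>x $ b\<close> remain.\<close>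

lemma integral_symbol:
  assumes fgh: "f \<in> harmonics" "g \<in> harmonics" "h \<in> harmonics"
  shows "(LINT x|lebesgue_on \<Omega>. symbol b g x * (f x * h x)) = 0"
proof -
  let ?X = "\<lambda>h x. complex_of_real (x $ b) * h x"
  have e: "f \<in> exp_polys" "g \<in> exp_polys" "h \<in> exp_polys" using fgh by (auto simp: harmonics_def)
  have cD: "continuous_on S (D_op is u)" if "u \<in> exp_polys" for "is" u and S :: "(real^'n) set"
    unfolding D_op_def using that by (intro continuous_intros exp_polys_continuous_on exp_polys_pderivs)
  note cont = cD continuous_on_coord_commutator exp_polys_continuous_on
  \<comment> \<open>\<open>T1\<close> is the integrand for the triple \<open>f\<close>,
    \<open>?X g\<close>, \<open>h\<close>, and \<open>T2\<close> the one for \<open>?X f\<close>,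
    \<open>g\<close>, \<open>h\<close>; \<open>T3\<close> is their difference.\<close>
  define T1 where "T1 j is x = tensor_comp (A j x) is * (?X g x * D_op is h x + h x * D_op is (?X g) x) * f x" for j "is" x
  define T2 where "T2 j is x = tensor_comp (A j x) is * (g x * D_op is h x + h x * D_op is g x) * ?X f x" for j "is" x
  define T3 where "T3 j is x = tensor_comp (A j x) is * ((1 / \<i> ^ j) * coord_commutator b is g x) * (f x * h x)" for j "is" x
  have int: "integrable (lebesgue_on \<Omega>) (T1 j is)" "integrable (lebesgue_on \<Omega>) (T2 j is)" "integrable (lebesgue_on \<Omega>) (T3 j is)"
    if "j \<in> {1..3}" "length is = j" for j "is"
    unfolding T1_def T2_def T3_def using that
    by (intro Linfty_integrable \<Omega> Linfty_mult_continuous tensor_comp_Linfty continuous_intros cont e exp_polys.intros; simp)+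
  have diff: "T1 j is x - T2 j is x = T3 j is x" if "length is = j" for j "is" x
    using that by (simp add: T1_def T2_def T3_def D_op_def coord_commutator_def algebra_simps)
  have q_eq: "(\<lambda>x. q x * ?X g x * h x * f x) = (\<lambda>x. q x * g x * h x * ?X f x)"
    by (simp add: fun_eq_iff mult_ac)
  have 1: "(\<Sum>j=1..3. \<Sum>is | length is = j. integral\<^sup>L (lebesgue_on \<Omega>) (T1 j is))
      + (LINT x|lebesgue_on \<Omega>. q x * ?X g x * h x * f x) = 0"
    unfolding T1_def by (intro identity3 harmonic_biharmonics coord_mult_biharmonics fgh)
  have 2: "(\<Sum>j=1..3. \<Sum>is | length is = j. integral\<^sup>L (lebesgue_on \<Omega>) (T2 j is))
      + (LINT x|lebesgue_on \<Omega>. q x * g x * h x * ?X f x) = 0"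
    unfolding T2_def by (intro identity3 harmonic_biharmonics coord_mult_biharmonics fgh)
  have "(\<Sum>j=1..3. \<Sum>is | length is = j. integral\<^sup>L (lebesgue_on \<Omega>) (T3 j is))
      = (\<Sum>j=1..3. \<Sum>is | length is = j. integral\<^sup>L (lebesgue_on \<Omega>) (T1 j is) - integral\<^sup>L (lebesgue_on \<Omega>) (T2 j is))"
    by (intro sum.cong refl) (simp add: int diff flip: Bochner_Integration.integral_diff)
  also have "\<dots> = 0"
    using trans[OF 1 2[symmetric]] unfolding sum_subtractf q_eq add_right_cancel right_minus_eq .
  finally have "(\<Sum>j=1..3. \<Sum>is | length is = j. integral\<^sup>L (lebesgue_on \<Omega>) (T3 j is)) = 0" .
  moreover have "(\<Sum>j=1..3. \<Sum>is | length is = j. integral\<^sup>L (lebesgue_on \<Omega>) (T3 j is))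
      = (\<Sum>j=1..3. LINT x|lebesgue_on \<Omega>. (\<Sum>is | length is = j. T3 j is x))"
    using int by (intro sum.cong refl Bochner_Integration.integral_sum[symmetric]) auto
  moreover have "\<dots> = (LINT x|lebesgue_on \<Omega>. (\<Sum>j=1..3. \<Sum>is | length is = j. T3 j is x))"
    using int by (intro Bochner_Integration.integral_sum[symmetric] Bochner_Integration.integrable_sum) auto
  moreover have "(\<Sum>j=1..3. \<Sum>is | length is = j. T3 j is x) = symbol b g x * (f x * h x)" for x
    by (simp add: symbol_def T3_def sum_distrib_right)
  ultimately show ?thesis by simp
qed

text \<open>Continuity up to the closure serves twice: it makes the symbol bounded, as the
  orthogonality criterion requires, and it upgrades vanishing almost everywhere to vanishing at
  every point.\<close>

lemma symbol_zero:
  assumes "g \<in> harmonics" "x \<in> \<Omega>"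
  shows "symbol b g x = 0"
proof -
  have c: "continuous_on (closure \<Omega>) (symbol b g)"
    using assms by (auto simp: harmonics_def intro: continuous_on_symbol)
  have "AE x in lebesgue_on \<Omega>. symbol b g x = 0"
    by (rule AE_zero_if_orthogonal_to_harmonic_products[OF card_ge_2 \<Omega>])
      (use integral_symbol assms(1) LinftyI_continuous[OF \<Omega> c] in auto)
  then show ?thesis
    using AE_zero_continuous_imp_zero[OF \<Omega>(1) continuous_on_subset[OF c closure_subset]] assms(2) by blast
qed

text \<open>Symmetry of the tensors makes the \<open>j\<close> possible positions of
  \<open>b\<close> contribute equally, so order \<open>j\<close> has the coefficient
  \<open>j / \<i> ^ j\<close>, that is \<open>- \<i>\<close>, \<open>- 2\<close> and
  \<open>3 * \<i>\<close>.\<close>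

lemma symbol_eq:
  assumes h: "h \<in> exp_polys" and x: "x \<in> closure \<Omega>"
  defines "a \<equiv> \<lambda>is. tensor_comp (A (length is) x) is"
  shows "symbol b h x = - \<i> * a [b] * h x - 2 * (\<Sum>j\<in>UNIV. a [b, j] * pderiv_at j h x)
    + 3 * \<i> * (\<Sum>j\<in>UNIV. \<Sum>k\<in>UNIV. a [b, j, k] * pderivs [j, k] h x)"
proof -
  have sym: "a is = a js" if "mset is = mset js" "length is \<in> {1..3}" for "is" js
    using A[OF that(2)] x that mset_eq_length[OF that(1)] unfolding a_def
    by (auto simp: cont_sym_tensor_fields_def intro: tensor_comp_cong)
  have L: "(\<Sum>is | length is = 0. f is) = f []" for f :: "'n list \<Rightarrow> complex"
    by simp
  define G where "G j k = pderivs [j, k] h x" for j k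
  have d: "(\<Sum>i\<in>UNIV. if i = b then f i else 0) = f b" for f :: "'n \<Rightarrow> complex"
    by simp
  have if_out: "(\<Sum>i\<in>I. if P then f i else 0) = (if P then (\<Sum>i\<in>I. f i) else 0)"
    for I :: "'n set" and P and f :: "'n \<Rightarrow> complex" by simp
  have m_if: "u * (of_bool P * v) = (if P then u * v else 0)" for u v :: complex and P by simp
  have 1: "(\<Sum>is | length is = 1. a is * coord_commutator b is h x) = a [b] * h x"
    by (simp add: sum_lists_Suc L coord_commutator_simps[OF h] m_if d del: pderivs.simps)
  have s2: "a [j, b] = a [b, j]" for j by (rule sym) auto
  have 2: "(\<Sum>is | length is = Suc 1. a is * coord_commutator b is h x) = 2 * (\<Sum>j\<in>UNIV. a [b, j] * pderiv_at j h x)"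
    by (simp add: sum_lists_Suc L coord_commutator_simps[OF h] m_if d distrib_left sum.distrib if_out s2 del: pderivs.simps)
  \<comment> \<open>Moving \<open>b\<close> to the front keeps the order of the other two indices,
    so the three sums over second derivatives coincide.\<close>
  have s3: "a [j, b, k] = a [b, j, k]" "a [j, k, b] = a [b, j, k]" for j k by (rule sym; auto)+
  have 3: "(\<Sum>is | length is = Suc (Suc 1). a is * coord_commutator b is h x) = 3 * (\<Sum>j\<in>UNIV. \<Sum>k\<in>UNIV. a [b, j, k] * G j k)"
    by (simp add: sum_lists_Suc L coord_commutator_simps[OF h] m_if d distrib_left sum.distrib if_out s3 sum_distrib_left[symmetric] flip: G_def del: pderivs.simps)
  have ij: "\<i> ^ 2 = -1" "\<i> ^ 3 = - \<i>" by (auto simp: power3_eq_cube)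
  have "symbol b h x = (\<Sum>j=1..3. (1 / \<i> ^ j) * (\<Sum>is | length is = j. a is * coord_commutator b is h x))"
    unfolding symbol_def sum_distrib_left by (intro sum.cong refl) (auto simp: a_def mult_ac)
  also have "{1..3::nat} = {1, Suc 1, Suc (Suc 1)}" by auto
  finally show ?thesis
    using 1 2 3 ij by (simp add: numeral_2_eq_2 numeral_3_eq_3 G_def del: pderivs.simps One_nat_def)
qed

text \<open>Harmonic polynomials of degree 0, 1 and 2 are inserted in turn, each order being
  eliminated before the next. In order three the slice of \<open>a\<close> at a fixed first index
  annihilates the Hessians of harmonic quadratics, so it is a multiple of the identity; symmetry in
  all three indices makes that multiple zero.\<close>

lemma tensor_comps_zero:
  assumes x: "x \<in> \<Omega>" and j: "j \<in> {1..3}" "length is = j"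
  shows "tensor_comp (A j x) is = 0"
proof -
  define a where "a is = tensor_comp (A (length is) x) is" for "is"
  have xc: "x \<in> closure \<Omega>" using x closure_subset by blast
  have sym: "a is = a js" if "mset is = mset js" "length is \<in> {1..3}" for "is" js
    using A[OF that(2)] xc that mset_eq_length[OF that(1)] unfolding a_def
    by (auto simp: cont_sym_tensor_fields_def intro: tensor_comp_cong)
  have Z: "- \<i> * a [b] * h x - 2 * (\<Sum>j\<in>UNIV. a [b, j] * pderiv_at j h x)
    + 3 * \<i> * (\<Sum>j\<in>UNIV. \<Sum>k\<in>UNIV. a [b, j, k] * pderivs [j, k] h x) = 0" if "h \<in> harmonics" for h b
    using symbol_eq[of h x b] symbol_zero[OF that x, of b] xc that by (simp add: a_def harmonics_def)
  have mi: "u * (if P then 1 else 0) = (if P then u else 0)" for u :: complex and P by simp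
  have a1: "a [b] = 0" for b
    using Z[OF harmonics_const[of 1], of b] by simp
  \<comment> \<open>The gradient of the coordinate \<open>c\<close> selects the single entry
    \<open>a [b, c]\<close>, and its second derivatives vanish.\<close>
  have a2: "a [b, c] = 0" for b c
    using Z[OF harmonics_coord[of c], of b] by (simp add: a1 mi)
  have quad: "(\<Sum>j\<in>UNIV. \<Sum>k\<in>UNIV. a [b, j, k] * pderivs [j, k] h x) = 0" if "h \<in> harmonics" for h b
    using Z[OF that, of b] by (simp add: a1 a2)
  have off: "a [b, k, l] = 0" if "k \<noteq> l" for b k l
  proof -
    \<comment> \<open>The Hessian of \<open>x $ k * x $ l\<close> has ones at the places (k, l) and
      (l, k) only.\<close>
    have "a [b, k, l] + a [b, l, k] = 0"
      using quad[OF harmonics_mult_coord[OF that], of b]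
      by (simp only: pderivs_coord_coord distrib_left sum.distrib sum_sum_of_bool_mult)
    moreover have "a [b, l, k] = a [b, k, l]" by (rule sym) auto
    ultimately show ?thesis by simp
  qed
  have diag: "a [b, k, k] = a [b, l, l]" for b k l
  proof -
    have "2 * a [b, k, k] - 2 * a [b, l, l] = 0"
      using quad[OF harmonics_diff_squares[of k l], of b]
      by (simp only: pderivs_diff exp_polys.intros pderivs_coord_coord right_diff_distrib distrib_left
          sum.distrib sum_subtractf sum_sum_of_bool_mult mult_2)
    then show ?thesis by simp
  qed
  have a3: "a [b, k, l] = 0" for b k l
  proof (cases "k = l")
    case True
    \<comment> \<open>A second index \<open>m\<close> is needed: \<open>a [b, m, m]\<close> equals
      \<open>a [m, b, m]\<close>, which is an off-diagonal entry of the slice at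
      \<open>m\<close>.\<close>
    have "(UNIV :: 'n set) \<noteq> {b}"
    proof
      assume "(UNIV :: 'n set) = {b}"
      then have "CARD('n) = card {b}" by simp
      then show False using card_ge_2 by simp
    qed
    then obtain m where m: "m \<noteq> b" by blast
    have "a [b, k, l] = a [b, m, m]" using True diag by simp
    also have "\<dots> = a [m, b, m]" by (rule sym) auto
    also have "\<dots> = 0" using off m by auto
    finally show ?thesis .
  qed (rule off)
  have "j = 1 \<or> j = 2 \<or> j = 3" using j by auto
  then have "a is = 0"
    using j(2) a1 a2 a3 by (auto simp: numeral_2_eq_2 numeral_3_eq_3 length_Suc_conv)
  then show ?thesis using j by (simp add: a_def)
qed

text \<open>All tensor terms now vanish in \<Omega>. With one test function equal to 1, what remains
  is the integral of \<open>q\<close> against a product of two harmonic functions.\<close>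

lemma q_zero: "AE x in lebesgue_on \<Omega>. q x = 0"
proof (rule AE_zero_if_orthogonal_to_harmonic_products[OF card_ge_2 \<Omega> q])
  fix g h :: "real^'n \<Rightarrow> complex" assume gh: "g \<in> harmonics" "h \<in> harmonics"
  have "(LINT x|lebesgue_on \<Omega>. tensor_comp (A j x) is * u x * f x) = 0" if "j \<in> {1..3}" "length is = j" for j "is" u f
  proof -
    have "(LINT x|lebesgue_on \<Omega>. tensor_comp (A j x) is * u x * f x) = (LINT x|lebesgue_on \<Omega>. 0)"
      using tensor_comps_zero[OF _ that] by (intro Bochner_Integration.integral_cong) auto
    then show ?thesis by simp
  qed
  then show "(LINT x|lebesgue_on \<Omega>. q x * (g x * h x)) = 0"
    using identity3[OF harmonic_biharmonics[OF gh(2)] harmonic_biharmonics[OF harmonics_const[of 1]] harmonic_biharmonics[OF gh(1)]]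
    by (simp add: mult.assoc)
qed

end

theorem theorem1p4:
  fixes \<Omega> :: "(real^'n::finite) set"
    and \<alpha> :: real
    and A :: "nat \<Rightarrow> real^'n \<Rightarrow> 'n tensor"
    and q :: "real^'n \<Rightarrow> complex"
  assumes "CARD('n) \<ge> 3"
    and "open \<Omega>" and "bounded \<Omega>" and "smooth_boundary \<Omega>"
    and "0 < \<alpha>" and "\<alpha> < 1"
    and "\<And>j. j \<in> {1..3} \<Longrightarrow> A j \<in> cont_sym_tensor_fields j (closure \<Omega>)"
    and "\<And>j x. j \<in> {1..3} \<Longrightarrow> x \<in> frontier \<Omega> \<Longrightarrow> tensor_zero j (A j x)"
    and "q \<in> Linfty \<Omega>"
    and "\<And>v :: nat \<Rightarrow> real^'n \<Rightarrow> complex.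
      (\<And>l. l \<in> {0..2} \<Longrightarrow>
         v l \<in> holder_space 4 \<alpha> \<Omega> \<and> (\<forall>x\<in>\<Omega>. (neg_laplacian ^^ 2) (v l) x = 0)) \<Longrightarrow>
      (\<Sum>j=1..3. \<Sum>is | length is = j.
         LINT x|lebesgue_on \<Omega>. tensor_comp (A j x) is *
           (v 1 x * D_op is (v 2) x + v 2 x * D_op is (v 1) x) * v 0 x)
      + (LINT x|lebesgue_on \<Omega>. q x * v 1 x * v 2 x * v 0 x) = 0"
  shows "(\<forall>j\<in>{1..3}. \<forall>x\<in>closure \<Omega>. tensor_zero j (A j x)) \<and>
         (AE x in lebesgue_on \<Omega>. q x = 0)"
proof -
  interpret integral_identity \<Omega> \<alpha> A q
    by (unfold_locales; (fact | use assms(1) in simp))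
  have "tensor_zero j (A j x)" if j: "j \<in> {1..3}" and x: "x \<in> closure \<Omega>" for j x
  \<comment> \<open>In \<Omega> the components vanish and determine the tensor. Since \<Omega> is
    open, the rest of its closure is the frontier, where vanishing is assumed.\<close>
  proof (cases "x \<in> \<Omega>")
    case True
    then show ?thesis
      using assms(7)[OF j] x tensor_comps_zero[OF True j]
      by (intro tensor_zeroI) (auto simp: cont_sym_tensor_fields_def)
  next
    case False
    then have "x \<in> frontier \<Omega>" using x assms(2) by (simp add: frontier_def interior_open)
    then show ?thesis by (rule assms(8)[OF j])
  qed
  then show ?thesis using q_zero by blast
qed

end
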